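(* Let $l\ge 1$ be an integer and let $G$ be a simple connected graph with $|E(G)|-|V(G)|=l-1$. Then an iterated random $n_k\cdots n_1$-lift of $G$ is connected with probability \[\left(1-\frac{1}{n_1^{l-1}}+O\left(\frac{1}{n_1^{l}}\right)\right)\prod_{i=2}^{k}\left(1-\frac{1}{n_i^{(l-1)\prod_{j=1}^{i-1}n_j}}+O\left(\frac{1}{n_i^{(l-1)\left(\prod_{j=1}^{i-1}n_j\right)+1}}\right)\right).\]
   Context: A random $n$-lift $\tilde H$ of a graph $H$ (loops and parallel edges allowed): orient the edges of $H$ arbitrarily and assign to each edge $e$ a permutation $\pi_e\in\mathcal{S}_n$, independently and uniformly at random; $\tilde H$ has vertex set $V(H)\times\{1,\dots,n\}$, with $(u,i)$ joined to $(v,j)$ iff there is an edge $e$ oriented from $u$ to $v$ with $\pi_e(i)=j$. An iterated random $n_k\cdots n_1$-lift of $G$ is obtained by letting $G_1$ be a random $n_1$-lift of $G$ and, for $i=2,\dots,k$, letting $G_i$ be a random $n_i$-lift of $G_{i-1}$ (with fresh independent randomness); the result is $G_k$. Equivalently, it is obtained by assigning to each edge of $G$ an independent uniform element of the iterated wreath product $\mathcal{S}_{n_k}\wr\cdots\wr\mathcal{S}_{n_1}$ acting on $[1,n_k]\times\cdots\times[1,n_1]$ and forming the lift on $V(G)\times[1,n_k]\times\cdots\times[1,n_1]$ in the same way. *)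

theory Defs
  imports "HOL-Probability.Probability" "HOL-Probability.Product_PMF" "Graph_Theory.Graph_Theory"
begin

text \<open>
  A finite multigraph with a chosen orientation is a \<^typ>\<open>('a, 'b) pre_digraph\<close> satisfying
  \<^const>\<open>fin_digraph\<close>: every undirected edge is represented by exactly one arc, so the number of
  edges is the number of arcs. Graph-theoretic connectedness is \<^const>\<open>Digraph_Component.connected\<close>,
  which ignores the orientation and requires at least one vertex.
\<close>

abbreviation graph_connected :: "('a, 'b) pre_digraph \<Rightarrow> bool" where
  "graph_connected \<equiv> Digraph_Component.connected"

text \<open>
  A finite simple graph with an arbitrary orientation. This is stronger than \<^const>\<open>digraph\<close>,
  which would admit two opposite arcs between the same vertices.
\<close>

definition oriented_simple_graph :: "('a, 'b) pre_digraph \<Rightarrow> bool" where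
  "oriented_simple_graph G \<longleftrightarrow> fin_digraph G \<and> loopfree_digraph G \<and>
     inj_on (\<lambda>e. {tail G e, head G e}) (arcs G)"

definition perm_lift :: "('a, 'b) pre_digraph \<Rightarrow> nat \<Rightarrow> ('b \<Rightarrow> nat \<Rightarrow> nat) \<Rightarrow> ('a \<times> nat, 'b \<times> nat) pre_digraph" where
  "perm_lift H n \<pi> =
     \<lparr>verts = verts H \<times> {1..n},
      arcs = arcs H \<times> {1..n},
      tail = (\<lambda>(e, i). (tail H e, i)),
      head = (\<lambda>(e, i). (head H e, \<pi> e i))\<rparr>"

definition random_lift :: "('a, 'b) pre_digraph \<Rightarrow> nat \<Rightarrow> ('a \<times> nat, 'b \<times> nat) pre_digraph pmf" where
  "random_lift H n =
     map_pmf (perm_lift H n) (Pi_pmf (arcs H) id (\<lambda>_. pmf_of_set {p. p permutes {1..n}}))"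

text \<open>
  Each lift changes the vertex and edge types. To iterate, the vertex
  \<open>((v, i\<^sub>1), \<dots>, i\<^sub>k)\<close> is renamed to \<open>(v, [i\<^sub>k, \<dots>, i\<^sub>1])\<close>, and likewise for edges.
  The map \<open>g\<close> below is only used when injective on the arcs.
\<close>

definition relabel :: "('a \<Rightarrow> 'c) \<Rightarrow> ('b \<Rightarrow> 'd) \<Rightarrow> ('a, 'b) pre_digraph \<Rightarrow> ('c, 'd) pre_digraph" where
  "relabel f g H =
     \<lparr>verts = f ` verts H,
      arcs = g ` arcs H,
      tail = (\<lambda>e. f (tail H (inv_into (arcs H) g e))),
      head = (\<lambda>e. f (head H (inv_into (arcs H) g e)))\<rparr>"

definition root_label :: "'a \<Rightarrow> 'a \<times> nat list" where
  "root_label x = (x, [])"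

definition push_label :: "('a \<times> nat list) \<times> nat \<Rightarrow> 'a \<times> nat list" where
  "push_label = (\<lambda>((x, is), i). (x, i # is))"

text \<open>
  The iterated random \<open>n\<^sub>k \<cdots> n\<^sub>1\<close>-lift. Only \<open>n 1, \<dots>, n k\<close> matter. The lift
  \<open>G\<^sub>i\<close> is oriented by inheriting the orientation of \<open>G\<^sub>i\<^sub>-\<^sub>1\<close>; the
  monadic bind supplies fresh independent permutations at every level.
\<close>

primrec iterated_random_lift ::
  "('a, 'b) pre_digraph \<Rightarrow> (nat \<Rightarrow> nat) \<Rightarrow> nat \<Rightarrow> ('a \<times> nat list, 'b \<times> nat list) pre_digraph pmf" where
  "iterated_random_lift G n 0 = return_pmf (relabel root_label root_label G)"
| "iterated_random_lift G n (Suc k) =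
     bind_pmf (iterated_random_lift G n k)
       (\<lambda>H. map_pmf (relabel push_label push_label) (random_lift H (n (Suc k))))"

end

theory Submission
  imports Defs
begin

text \<open>
  Let \<open>H\<close> be a connected multigraph with \<open>r = |E| - |V| \<ge> 0\<close>, and let \<open>p\<^sub>n\<close> be the probability
  that its random \<open>n\<close>-lift is connected. A component of the lift meets all fibres in the same number
  \<open>d\<close> of points. Sorting all \<open>n!^|E|\<close> lifts by the component of one fixed point gives
  \<open>1 = (\<Sum>d = 1..n. (d / n) * (n choose d) ^ (- r) * p\<^sub>d)\<close>, so \<open>p\<^sub>n\<close> depends only on \<open>n\<close> and \<open>r\<close>.
  For \<open>r = 0\<close> this forces \<open>p\<^sub>n = 1 / n\<close>. For \<open>r \<ge> 1\<close>, the terms \<open>d = 1\<close> and \<open>d = n - 1\<close>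
  together contribute \<open>1 / n ^ r\<close> up to \<open>O(1 / n ^ (r + 1))\<close>, and the other terms with \<open>d < n\<close> are of this smaller order, uniformly in \<open>r\<close>. Since \<open>|E| - |V|\<close> is
  multiplied by \<open>n\<close> under an \<open>n\<close>-lift and only lifts of connected graphs can be connected, the
  probabilities of the successive levels multiply.
\<close>

section \<open>Components and connectedness\<close>

text \<open>The saturated sets are the unions of connected components. Their closure under
  intersection and difference replaces arguments with walks, which enter only in
  \<open>connected_iff_is_component\<close>.\<close>

definition saturated :: "('a, 'b) pre_digraph \<Rightarrow> 'a set \<Rightarrow> bool" where
  "saturated G U \<longleftrightarrow> U \<subseteq> verts G \<and> (\<forall>e\<in>arcs G. tail G e \<in> U \<longleftrightarrow> head G e \<in> U)"

definition is_component :: "('a, 'b) pre_digraph \<Rightarrow> 'a set \<Rightarrow> bool" where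
  "is_component G W \<longleftrightarrow> saturated G W \<and> W \<noteq> {} \<and>
     (\<forall>U. saturated G U \<and> U \<noteq> {} \<and> U \<subseteq> W \<longrightarrow> U = W)"

lemma saturated_verts:
  assumes "wf_digraph G"
  shows "saturated G (verts G)"
  using assms by (auto simp: saturated_def wf_digraph_def)

lemma saturated_Int: "saturated G U \<Longrightarrow> saturated G W \<Longrightarrow> saturated G (U \<inter> W)"
  by (auto simp: saturated_def)

lemma saturated_Diff: "saturated G U \<Longrightarrow> saturated G W \<Longrightarrow> saturated G (U - W)"
  by (auto simp: saturated_def)

text \<open>The vertices reachable from \<open>u\<close> in the symmetric closure form a saturated
  set, and every saturated set containing \<open>u\<close> contains all of them.\<close>

lemma connected_iff_is_component:
  assumes "wf_digraph G"
  shows "graph_connected G \<longleftrightarrow> is_component G (verts G)"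
proof -
  interpret S: pair_wf_digraph "mk_symmetric G"
    using assms by (rule wf_digraph.wellformed_mk_symmetric)
  define reach where "reach = rtrancl_on (verts G) (parcs (mk_symmetric G))"
  have conn: "graph_connected G \<longleftrightarrow>
      verts G \<noteq> {} \<and> (\<forall>u\<in>verts G. \<forall>v\<in>verts G. (u, v) \<in> reach)"
    by (simp add: connected_def strongly_connected_def reachable_def reach_def)
  have wf: "tail G e \<in> verts G" "head G e \<in> verts G" if "e \<in> arcs G" for e
    using assms that by (auto simp: wf_digraph_def)
  show ?thesis
  proof
    assume c: "graph_connected G"
    have "U = verts G" if U: "saturated G U" "U \<noteq> {}" for U
    proof -
      obtain u where u: "u \<in> U" using U by blast
      have "v \<in> U" if "(u, v) \<in> reach" for v
        using that unfolding reach_def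
      proof (induction rule: rtrancl_on_induct)
        case (step y z)
        then show ?case using U by (auto simp: parcs_mk_symmetric saturated_def)
      qed (use u in auto)
      then have "verts G \<subseteq> U"
        using c u U unfolding conn saturated_def by blast
      then show ?thesis using U by (auto simp: saturated_def)
    qed
    then show "is_component G (verts G)"
      using c saturated_verts[OF assms] unfolding conn is_component_def by blast
  next
    assume c: "is_component G (verts G)"
    have "(u, v) \<in> reach" if uv: "u \<in> verts G" "v \<in> verts G" for u v
    proof -
      have "(u, x) \<in> reach \<longleftrightarrow> (u, y) \<in> reach"
        if "(x, y) \<in> parcs (mk_symmetric G)" "(y, x) \<in> parcs (mk_symmetric G)"
          "x \<in> verts G" "y \<in> verts G" for x y
        using that unfolding reach_def by (meson rtrancl_on_into_rtrancl_on)
      then have "saturated G {x \<in> verts G. (u, x) \<in> reach}"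
        using wf by (auto simp: saturated_def parcs_mk_symmetric)
      moreover have "u \<in> {x \<in> verts G. (u, x) \<in> reach}"
        using uv by (auto simp: reach_def)
      ultimately have "{x \<in> verts G. (u, x) \<in> reach} = verts G"
        using c unfolding is_component_def by blast
      then show ?thesis using uv by blast
    qed
    then show "graph_connected G"
      using c unfolding conn is_component_def by blast
  qed
qed

text \<open>The component of \<open>x\<close> is the intersection of all saturated sets through
  \<open>x\<close>; two components that meet both equal their intersection by minimality.\<close>

lemma ex1_is_component:
  assumes "wf_digraph G" "x \<in> verts G"
  shows "\<exists>!W. is_component G W \<and> x \<in> W"
proof (rule ex_ex1I)
  define W where "W = \<Inter>{U. saturated G U \<and> x \<in> U}"
  have x: "x \<in> W" by (auto simp: W_def)
  have W: "saturated G W"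
    using saturated_verts[OF assms(1)] assms(2) by (auto simp: W_def saturated_def)
  have "U = W" if U: "saturated G U" "U \<noteq> {}" "U \<subseteq> W" for U
  proof (cases "x \<in> U")
    case True
    then show ?thesis using U by (auto simp: W_def)
  next
    case False
    \<comment> \<open>If \<open>U\<close> misses \<open>x\<close>, then \<open>W - U\<close> is
      itself a saturated set through \<open>x\<close>, so it must contain \<open>W\<close>.\<close>
    then have "W \<subseteq> W - U"
      using saturated_Diff[OF W U(1)] x unfolding W_def by blast
    then show ?thesis using U by blast
  qed
  then show "\<exists>W. is_component G W \<and> x \<in> W"
    using x W by (auto simp: is_component_def)
next
  fix W W' assume *: "is_component G W \<and> x \<in> W" "is_component G W' \<and> x \<in> W'"
  then have "saturated G (W \<inter> W')" "W \<inter> W' \<noteq> {}"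
    by (auto simp: is_component_def intro: saturated_Int)
  then have "W \<inter> W' = W" "W \<inter> W' = W'"
    using * unfolding is_component_def by blast+
  then show "W = W'" by simp
qed

text \<open>Saturation sees only the end points of arcs, so \<open>f\<close> carries saturated sets
  to saturated sets in both directions and preserves minimality. This serves for relabelling and for
  renumbering the fibres of a lift.\<close>

lemma is_component_iso:
  assumes "wf_digraph G" "inj_on f (verts G)" "verts G' = f ` verts G" "arcs G' = h ` arcs G"
    and "\<And>a. a \<in> arcs G \<Longrightarrow> tail G' (h a) = f (tail G a)"
    and "\<And>a. a \<in> arcs G \<Longrightarrow> head G' (h a) = f (head G a)"
    and "W \<subseteq> verts G"
  shows "is_component G' (f ` W) \<longleftrightarrow> is_component G W"
proof -
  have sat: "saturated G' (f ` U) \<longleftrightarrow> saturated G U" if "U \<subseteq> verts G" for U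
  proof -
    have "f x \<in> f ` U \<longleftrightarrow> x \<in> U" if "x \<in> verts G" for x
      using \<open>U \<subseteq> verts G\<close> assms(2) that by (auto dest: inj_onD)
    then show ?thesis
      using that assms(1,3-6) by (auto simp: saturated_def wf_digraph_def)
  qed
  have ex: "\<exists>U. U \<subseteq> verts G \<and> U' = f ` U" if "saturated G' U'" for U'
    using that assms(3) by (simp add: saturated_def subset_image_iff)
  have eq: "f ` U \<subseteq> f ` W \<longleftrightarrow> U \<subseteq> W" "f ` U = f ` W \<longleftrightarrow> U = W" if "U \<subseteq> verts G" for U
    using that assms(2,7) by (auto simp: inj_on_image_subset_iff inj_on_image_eq_iff)
  show ?thesis
  proof
    assume c: "is_component G W"
    show "is_component G' (f ` W)"
      unfolding is_component_def
    proof (intro conjI allI impI)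
      fix U' assume U': "saturated G' U' \<and> U' \<noteq> {} \<and> U' \<subseteq> f ` W"
      then obtain U where "U \<subseteq> verts G" "U' = f ` U" using ex by blast
      then show "U' = f ` W"
        using U' c sat eq unfolding is_component_def by (metis image_is_empty)
    qed (use c sat assms(7) in \<open>auto simp: is_component_def\<close>)
  next
    assume c: "is_component G' (f ` W)"
    show "is_component G W"
      unfolding is_component_def
    proof (intro conjI allI impI)
      fix U assume U: "saturated G U \<and> U \<noteq> {} \<and> U \<subseteq> W"
      then have "U \<subseteq> verts G" using assms(7) by blast
      then show "U = W"
        using U c sat eq unfolding is_component_def by (metis image_is_empty)
    qed (use c sat assms(7) in \<open>auto simp: is_component_def\<close>)
  qed
qed

section \<open>Relabellings and lifts: well-formedness and connectedness\<close>

lemma fin_digraph_relabel: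
  assumes "fin_digraph G" "inj_on g (arcs G)"
  shows "fin_digraph (relabel f g G)"
proof -
  interpret fin_digraph G by fact
  show ?thesis
    by unfold_locales (auto simp: relabel_def inv_into_f_f[OF assms(2)])
qed

lemma connected_relabel:
  assumes "fin_digraph G" "inj_on f (verts G)" "inj_on g (arcs G)"
  shows "graph_connected (relabel f g G) \<longleftrightarrow> graph_connected G"
proof -
  have wf: "wf_digraph G" "wf_digraph (relabel f g G)"
    using assms fin_digraph_relabel by (auto simp: fin_digraph_def)
  have "is_component (relabel f g G) (f ` verts G) \<longleftrightarrow> is_component G (verts G)"
    by (rule is_component_iso[OF wf(1) assms(2)])
      (auto simp: relabel_def inv_into_f_f[OF assms(3)])
  then show ?thesis
    by (simp add: connected_iff_is_component wf) (simp add: relabel_def)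
qed

lemma fin_digraph_perm_lift:
  assumes "fin_digraph H" "\<And>e. e \<in> arcs H \<Longrightarrow> \<pi> e permutes {1..n}"
  shows "fin_digraph (perm_lift H n \<pi>)"
proof -
  interpret fin_digraph H by fact
  show ?thesis
    by unfold_locales (auto simp: perm_lift_def permutes_in_image[OF assms(2), simplified])
qed

text \<open>The full preimage \<open>U \<times> {1..n}\<close> of a saturated set of
  \<open>H\<close> is saturated in the lift; as \<open>n \<ge> 1\<close>, it determines
  \<open>U\<close>.\<close>

lemma connected_perm_liftD:
  assumes "fin_digraph H" "\<And>e. e \<in> arcs H \<Longrightarrow> \<pi> e permutes {1..n}" "n \<ge> 1"
    and conn: "graph_connected (perm_lift H n \<pi>)"
  shows "graph_connected H"
proof -
  have wf: "wf_digraph H" using assms(1) by (simp add: fin_digraph_def)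
  have "wf_digraph (perm_lift H n \<pi>)"
    using fin_digraph_perm_lift[OF assms(1,2)] by (simp add: fin_digraph_def)
  then have c: "is_component (perm_lift H n \<pi>) (verts H \<times> {1..n})"
    using conn by (simp add: connected_iff_is_component) (simp add: perm_lift_def)
  then have nonempty: "verts H \<noteq> {}" by (auto simp: is_component_def)
  have "U = verts H" if U: "saturated H U" "U \<noteq> {}" for U
  proof -
    have "saturated (perm_lift H n \<pi>) (U \<times> {1..n})"
      using U permutes_in_image[OF assms(2)] by (auto simp: saturated_def perm_lift_def)
    then have "U \<times> {1..n} = verts H \<times> {1..n}"
      using c U \<open>n \<ge> 1\<close> unfolding is_component_def
      by (metis Sigma_empty2 saturated_def Times_empty Sigma_mono order_refl)
    then show ?thesis using \<open>n \<ge> 1\<close> by (auto simp: set_eq_iff)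
  qed
  then have "is_component H (verts H)"
    using nonempty saturated_verts[OF wf] unfolding is_component_def by blast
  then show ?thesis by (simp add: connected_iff_is_component[OF wf])
qed

section \<open>Counting lifts by a component\<close>

lemma permutes_restrict_invariant:
  assumes "p permutes S" "p ` A = A"
  shows "(\<lambda>i. if i \<in> A then p i else i) permutes A"
proof (rule bij_imp_permutes)
  show "bij_betw (\<lambda>i. if i \<in> A then p i else i) A A"
    using assms by (auto simp: bij_betw_def inj_on_def dest: permutes_inj[THEN injD])
qed auto

text \<open>A bijection from \<open>A\<close> to \<open>B\<close> is glued with one between the
  complements. Such a permutation moves \<open>{1..d}\<close> onto the slice of a component over a
  given vertex.\<close>

lemma ex_permutes_image_eq:
  assumes "finite T" "A \<subseteq> T" "B \<subseteq> T" "card A = card B"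
  shows "\<exists>g. g permutes T \<and> g ` A = B"
proof -
  have fin: "finite A" "finite B"
    using assms finite_subset by blast+
  then obtain f where f: "bij_betw f A B"
    using assms(4) finite_same_card_bij by blast
  have "card (T - A) = card (T - B)"
    using assms fin by (simp add: card_Diff_subset)
  then obtain h where h: "bij_betw h (T - A) (T - B)"
    using assms(1) finite_same_card_bij[of "T - A" "T - B"] by blast
  define g where "g x = (if x \<in> A then f x else if x \<in> T then h x else x)" for x
  have gA: "bij_betw g A B"
    using bij_betw_cong[of A g f] f by (simp add: g_def)
  moreover have "bij_betw g (T - A) (T - B)"
    using bij_betw_cong[of "T - A" g h] h by (simp add: g_def)
  ultimately have "bij_betw g (A \<union> (T - A)) (B \<union> (T - B))"
    by (rule bij_betw_combine) blast
  then have "bij_betw g T T"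
    using assms(2,3) by (simp add: Un_absorb1)
  then have "g permutes T"
    by (rule bij_imp_permutes) (use assms(2) in \<open>auto simp: g_def\<close>)
  then show ?thesis
    using gA by (auto simp: bij_betw_def)
qed

lemma card_subsets_containing:
  assumes "finite T" "x \<in> T" "d \<ge> 1"
  shows "card {X. X \<subseteq> T \<and> card X = d \<and> x \<in> X} = (card T - 1) choose (d - 1)"
proof -
  have "bij_betw (insert x) {X. X \<subseteq> T - {x} \<and> card X = d - 1} {X. X \<subseteq> T \<and> card X = d \<and> x \<in> X}"
  proof (rule bij_betw_byWitness[where f' = "\<lambda>X. X - {x}"])
    show "insert x ` {X. X \<subseteq> T - {x} \<and> card X = d - 1} \<subseteq> {X. X \<subseteq> T \<and> card X = d \<and> x \<in> X}"
    proof safe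
      fix X assume X: "X \<subseteq> T - {x}" "card X = d - 1"
      then have "finite X" using assms(1) finite_subset by blast
      then show "card (insert x X) = d"
        using X assms(3) by (subst card_insert_disjoint) auto
    qed (use assms in auto)
  qed (use assms in auto)
  then have "card {X. X \<subseteq> T \<and> card X = d \<and> x \<in> X} = card {X. X \<subseteq> T - {x} \<and> card X = d - 1}"
    by (simp add: bij_betw_same_card)
  also have "\<dots> = (card T - 1) choose (d - 1)"
    using assms by (simp add: n_subsets)
  finally show ?thesis .
qed

section \<open>The sample space of a random lift\<close>

text \<open>For \<open>T = {1..n}\<close> this is the sample space of a random
  \<open>n\<close>-lift: the default \<open>id\<close> off \<open>A\<close> is the one that
  \<open>random_lift\<close> passes to \<open>Pi_pmf\<close>. Other sets \<open>T\<close> occur when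
  a system is split into two blocks.\<close>

definition perm_systems :: "'b set \<Rightarrow> nat set \<Rightarrow> ('b \<Rightarrow> nat \<Rightarrow> nat) set" where
  "perm_systems A T = PiE_dflt A id (\<lambda>_. {p. p permutes T})"

lemma perm_systems_iff:
  "\<pi> \<in> perm_systems A T \<longleftrightarrow> (\<forall>e\<in>A. \<pi> e permutes T) \<and> (\<forall>e. e \<notin> A \<longrightarrow> \<pi> e = id)"
  by (auto simp: perm_systems_def PiE_dflt_def)

lemma finite_perm_systems: "finite A \<Longrightarrow> finite T \<Longrightarrow> finite (perm_systems A T)"
  unfolding perm_systems_def by (intro finite_PiE_dflt) (simp_all add: finite_permutations)

lemma card_perm_systems:
  "finite A \<Longrightarrow> finite T \<Longrightarrow> card (perm_systems A T) = fact (card T) ^ card A"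
  unfolding perm_systems_def by (subst card_PiE_dflt) (simp_all add: card_permutations finite_permutations)

lemma wf_perm_lift:
  assumes "fin_digraph H" "\<pi> \<in> perm_systems (arcs H) {1..n}"
  shows "wf_digraph (perm_lift H n \<pi>)"
  using fin_digraph_perm_lift[OF assms(1)] assms(2)
  by (auto simp: perm_systems_iff fin_digraph_def)

text \<open>For a saturated \<open>W\<close>, each \<open>\<pi> e\<close> maps the slice over the
  tail bijectively onto the slice over the head. Hence the vertices whose slice has the same size as
  that of \<open>u\<close> form a saturated set of the connected \<open>H\<close>.\<close>

lemma card_slice_eq:
  assumes "fin_digraph H" "graph_connected H" "\<pi> \<in> perm_systems (arcs H) {1..n}"
    and W: "saturated (perm_lift H n \<pi>) W"
    and uv: "u \<in> verts H" "v \<in> verts H"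
  shows "card (W `` {v}) = card (W `` {u})"
proof -
  interpret fin_digraph H by fact
  have perm: "\<pi> e permutes {1..n}" if "e \<in> arcs H" for e
    using assms(3) that by (simp add: perm_systems_iff)
  have "W `` {head H e} = \<pi> e ` (W `` {tail H e})" if e: "e \<in> arcs H" for e
  proof (intro equalityI subsetI)
    fix j assume j: "j \<in> W `` {head H e}"
    then have "j \<in> {1..n}" using W by (auto simp: saturated_def perm_lift_def)
    then obtain i where "i \<in> {1..n}" "j = \<pi> e i"
      using permutes_image[OF perm[OF e]] by blast
    then show "j \<in> \<pi> e ` (W `` {tail H e})"
      using j W e by (force simp: saturated_def perm_lift_def)
  next
    fix j assume "j \<in> \<pi> e ` (W `` {tail H e})"
    then obtain i where i: "j = \<pi> e i" "(tail H e, i) \<in> W" by auto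
    then have "i \<in> {1..n}" using W by (auto simp: saturated_def perm_lift_def)
    then show "j \<in> W `` {head H e}"
      using i W e by (force simp: saturated_def perm_lift_def)
  qed
  then have "card (W `` {head H e}) = card (W `` {tail H e})" if "e \<in> arcs H" for e
    using that perm[OF that] by (simp add: card_image permutes_inj_on)
  then have "saturated H {x \<in> verts H. card (W `` {x}) = card (W `` {u})}"
    by (auto simp: saturated_def)
  then have "{x \<in> verts H. card (W `` {x}) = card (W `` {u})} = verts H"
    using assms(2) uv unfolding connected_iff_is_component[OF wf_digraph_axioms] is_component_def
    by blast
  then show ?thesis using uv by blast
qed

section \<open>Lifts with a prescribed component\<close>

lemma image_fibrewise: "(\<lambda>(x, i). (x, q x i)) ` (X \<times> I) = (SIGMA x:X. q x ` I)"
  by force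

text \<open>Renumbering the fibre over each \<open>v\<close> by \<open>g v\<close> is an isomorphism
  of lifts. It replaces \<open>\<pi> e\<close> by
  \<open>g (head H e) \<circ> \<pi> e \<circ> inv (g (tail H e))\<close>, and this is a bijection of
  the set of all systems, with inverse \<open>\<Delta>\<close>.\<close>

lemma card_component_systems_conjugate:
  assumes "fin_digraph H" and g: "\<And>v. v \<in> verts H \<Longrightarrow> g v permutes {1..n}"
    and W: "W \<subseteq> verts H \<times> {1..n}"
  shows "card {\<pi> \<in> perm_systems (arcs H) {1..n}.
             is_component (perm_lift H n \<pi>) ((\<lambda>(v, i). (v, g v i)) ` W)} =
         card {\<pi> \<in> perm_systems (arcs H) {1..n}. is_component (perm_lift H n \<pi>) W}"
    (is "card ?L = card ?R")
proof -
  interpret fin_digraph H by fact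
  define \<Gamma> where "\<Gamma> \<pi> = (\<lambda>e. if e \<in> arcs H
      then g (head H e) \<circ> \<pi> e \<circ> inv (g (tail H e)) else id)" for \<pi> :: "_ \<Rightarrow> nat \<Rightarrow> nat"
  define \<Delta> where "\<Delta> \<pi> = (\<lambda>e. if e \<in> arcs H
      then inv (g (head H e)) \<circ> \<pi> e \<circ> g (tail H e) else id)" for \<pi> :: "_ \<Rightarrow> nat \<Rightarrow> nat"
  define f where "f = (\<lambda>(v :: 'a, i). (v, g v i))"
  have perm: "g (head H e) permutes {1..n}" "g (tail H e) permutes {1..n}" if "e \<in> arcs H" for e
    using that g by auto
  have inverses: "g (head H e) \<circ> inv (g (head H e)) = id" "inv (g (head H e)) \<circ> g (head H e) = id"
    "g (tail H e) \<circ> inv (g (tail H e)) = id" "inv (g (tail H e)) \<circ> g (tail H e) = id"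
    if "e \<in> arcs H" for e
    using perm[OF that] permutes_inv_o by blast+
  have \<Gamma>: "\<Gamma> \<pi> \<in> perm_systems (arcs H) {1..n}" if "\<pi> \<in> perm_systems (arcs H) {1..n}" for \<pi>
    using that perm by (auto simp: perm_systems_iff \<Gamma>_def intro!: permutes_compose permutes_inv)
  have \<Delta>: "\<Delta> \<pi> \<in> perm_systems (arcs H) {1..n}" if "\<pi> \<in> perm_systems (arcs H) {1..n}" for \<pi>
    using that perm by (auto simp: perm_systems_iff \<Delta>_def intro!: permutes_compose permutes_inv)
  have \<Gamma>\<Delta>: "\<Gamma> (\<Delta> \<pi>) = \<pi>" if "\<pi> \<in> perm_systems (arcs H) {1..n}" for \<pi>
  proof
    fix e
    show "\<Gamma> (\<Delta> \<pi>) e = \<pi> e"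
    proof (cases "e \<in> arcs H")
      case True
      then have "\<Gamma> (\<Delta> \<pi>) e = (g (head H e) \<circ> inv (g (head H e))) \<circ> \<pi> e \<circ> (g (tail H e) \<circ> inv (g (tail H e)))"
        by (simp add: \<Gamma>_def \<Delta>_def comp_assoc)
      then show ?thesis using inverses[OF True] by simp
    qed (use that in \<open>simp add: \<Gamma>_def perm_systems_iff\<close>)
  qed
  have \<Delta>\<Gamma>: "\<Delta> (\<Gamma> \<pi>) = \<pi>" if "\<pi> \<in> perm_systems (arcs H) {1..n}" for \<pi>
  proof
    fix e
    show "\<Delta> (\<Gamma> \<pi>) e = \<pi> e"
    proof (cases "e \<in> arcs H")
      case True
      then have "\<Delta> (\<Gamma> \<pi>) e = (inv (g (head H e)) \<circ> g (head H e)) \<circ> \<pi> e \<circ> (inv (g (tail H e)) \<circ> g (tail H e))"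
        by (simp add: \<Gamma>_def \<Delta>_def comp_assoc)
      then show ?thesis using inverses[OF True] by simp
    qed (use that in \<open>simp add: \<Delta>_def perm_systems_iff\<close>)
  qed
  have comp: "is_component (perm_lift H n (\<Gamma> \<pi>)) (f ` W) \<longleftrightarrow> is_component (perm_lift H n \<pi>) W"
    if "\<pi> \<in> perm_systems (arcs H) {1..n}" for \<pi>
  \<comment> \<open>The arc \<open>(e, i)\<close> starts at \<open>(tail H e, i)\<close>, so its
    number has to follow the permutation of the fibre over the tail.\<close>
  proof (rule is_component_iso[where h = "\<lambda>(e, i). (e, g (tail H e) i)"])
    show "wf_digraph (perm_lift H n \<pi>)"
      using assms(1) that by (rule wf_perm_lift)
    show "inj_on f (verts (perm_lift H n \<pi>))"
      by (auto simp: inj_on_def f_def perm_lift_def dest: permutes_inj[OF g, THEN injD])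
    have img: "(\<lambda>(x, i). (x, q x i)) ` (X \<times> {1..n}) = X \<times> {1..n}"
      if "\<And>x. x \<in> X \<Longrightarrow> q x permutes {1..n}" for X :: "'c set" and q
      using permutes_image[OF that] by (simp add: image_fibrewise cong: Sigma_cong)
    show "verts (perm_lift H n (\<Gamma> \<pi>)) = f ` verts (perm_lift H n \<pi>)"
      using img[of "verts H" g] g by (simp add: perm_lift_def f_def)
    show "arcs (perm_lift H n (\<Gamma> \<pi>)) = (\<lambda>(e, i). (e, g (tail H e) i)) ` arcs (perm_lift H n \<pi>)"
      using img[of "arcs H" "\<lambda>e. g (tail H e)"] perm by (simp add: perm_lift_def)
    show "W \<subseteq> verts (perm_lift H n \<pi>)"
      using W by (simp add: perm_lift_def)
  qed (use inverses in \<open>auto simp: perm_lift_def f_def \<Gamma>_def fun_eq_iff\<close>)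
  have "bij_betw \<Gamma> ?R ?L"
  proof (rule bij_betw_byWitness[where f' = \<Delta>])
    show "\<Gamma> ` ?R \<subseteq> ?L"
      using \<Gamma> comp by (auto simp: f_def)
    show "\<Delta> ` ?L \<subseteq> ?R"
      using \<Delta> comp \<Gamma>\<Delta> by (fastforce simp: f_def)
  qed (use \<Gamma>\<Delta> \<Delta>\<Gamma> in auto)
  then show ?thesis by (simp add: bij_betw_same_card)
qed

lemma saturated_perm_lift_iff:
  "saturated (perm_lift H n \<pi>) U \<longleftrightarrow> U \<subseteq> verts H \<times> {1..n} \<and>
    (\<forall>e\<in>arcs H. \<forall>i\<in>{1..n}. (tail H e, i) \<in> U \<longleftrightarrow> (head H e, \<pi> e i) \<in> U)"
  by (auto simp: saturated_def perm_lift_def)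

definition connected_lifts :: "('a, 'b) pre_digraph \<Rightarrow> nat \<Rightarrow> ('b \<Rightarrow> nat \<Rightarrow> nat) set" where
  "connected_lifts H n = {\<pi> \<in> perm_systems (arcs H) {1..n}. graph_connected (perm_lift H n \<pi>)}"

text \<open>Saturation makes each \<open>\<pi> e\<close> map \<open>{1..d}\<close> into itself,
  hence onto itself by finiteness. \<open>perm_lift H d \<pi>\<close> only depends on the values of
  \<open>\<pi>\<close> on \<open>{1..d}\<close>, so on invariant blocks it is the part of the
  \<open>n\<close>-lift over \<open>{1..d}\<close>.\<close>

lemma is_component_initial_fibres:
  assumes "fin_digraph H" "\<pi> \<in> perm_systems (arcs H) {1..n}" "d \<le> n"
  shows "is_component (perm_lift H n \<pi>) (verts H \<times> {1..d}) \<longleftrightarrow>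
    (\<forall>e\<in>arcs H. \<pi> e ` {1..d} = {1..d}) \<and> is_component (perm_lift H d \<pi>) (verts H \<times> {1..d})"
proof -
  interpret fin_digraph H by fact
  have perm: "\<pi> e permutes {1..n}" if "e \<in> arcs H" for e
    using assms(2) that by (simp add: perm_systems_iff)
  have inv: "\<pi> e ` {1..d} = {1..d}"
    if "saturated (perm_lift H n \<pi>) (verts H \<times> {1..d})" "e \<in> arcs H" for e
  proof -
    have "\<pi> e ` {1..d} \<subseteq> {1..d}"
      using that assms(3) by (fastforce simp: saturated_def perm_lift_def)
    then show ?thesis
      using permutes_inj_on[OF perm[OF that(2)]] by (simp add: endo_inj_surj)
  qed
  have sat: "saturated (perm_lift H n \<pi>) U \<longleftrightarrow> saturated (perm_lift H d \<pi>) U"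
    if "\<forall>e\<in>arcs H. \<pi> e ` {1..d} = {1..d}" "U \<subseteq> verts H \<times> {1..d}" for U
  proof -
    \<comment> \<open>Arcs numbered outside \<open>{1..d}\<close> also end outside it, so they
      impose no condition on \<open>U\<close>.\<close>
    have "\<pi> e i \<notin> {1..d}" if "e \<in> arcs H" "i \<notin> {1..d}" for e i
      using that \<open>\<forall>e\<in>arcs H. _\<close> permutes_inj[OF perm[OF that(1)]]
      by (metis inj_image_mem_iff)
    then have "(tail H e, i) \<in> U \<longleftrightarrow> (head H e, \<pi> e i) \<in> U" if "e \<in> arcs H" "i \<notin> {1..d}" for e i
      using that \<open>U \<subseteq> _\<close> by blast
    moreover have "U \<subseteq> verts H \<times> {1..n}" "{1..d} \<subseteq> {1..n}"
      using that(2) assms(3) by auto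
    ultimately show ?thesis
      using that(2) unfolding saturated_perm_lift_iff by blast
  qed
  show ?thesis
    using inv sat unfolding is_component_def by (smt (verit) order_refl)
qed

text \<open>Such a system preserves the blocks \<open>{1..d}\<close> and \<open>{Suc d..n}\<close>
  on every arc. On the first block it is a connected \<open>d\<close>-lift, on the second it is
  arbitrary, with \<open>fact (n - d)\<close> choices per arc.\<close>

lemma card_initial_component_systems:
  assumes "fin_digraph H" "d \<le> n"
  shows "card {\<pi> \<in> perm_systems (arcs H) {1..n}. is_component (perm_lift H n \<pi>) (verts H \<times> {1..d})} =
    card (connected_lifts H d) * fact (n - d) ^ card (arcs H)"
proof -
  interpret fin_digraph H by fact
  let ?P = "perm_systems (arcs H)"
  let ?L = "{\<pi> \<in> ?P {1..n}. is_component (perm_lift H n \<pi>) (verts H \<times> {1..d})}"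
  \<comment> \<open>Restriction to an invariant block, extended by the identity; the two
    restrictions give the inverse of the bijection below.\<close>
  define r where "r T \<sigma> = (\<lambda>e i. if i \<in> T then \<sigma> e i else i)"
    for T and \<sigma> :: "'b \<Rightarrow> nat \<Rightarrow> nat"
  have restrict: "r T \<sigma> \<in> ?P T"
    if \<sigma>: "\<sigma> \<in> ?P {1..n}" and T: "\<And>e. e \<in> arcs H \<Longrightarrow> \<sigma> e ` T = T" for T \<sigma>
    unfolding perm_systems_iff
  proof (intro conjI ballI allI impI)
    show "r T \<sigma> e permutes T" if "e \<in> arcs H" for e
      unfolding r_def
      by (rule permutes_restrict_invariant[of _ "{1..n}"]) (use \<sigma> T that in \<open>simp_all add: perm_systems_iff\<close>)
    show "r T \<sigma> e = id" if "e \<notin> arcs H" for e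
      using that \<sigma> by (auto simp: r_def perm_systems_iff)
  qed
  have split: "{1..d} \<union> {Suc d..n} = {1..n}"
    using assms(2) by auto
  have conn: "graph_connected (perm_lift H d \<pi>) \<longleftrightarrow> is_component (perm_lift H d \<pi>) (verts H \<times> {1..d})"
    if "\<pi> \<in> ?P {1..d}" for \<pi>
    using connected_iff_is_component[OF wf_perm_lift[OF assms(1) that]]
    by (simp add: perm_lift_def)
  have lift_cong: "is_component (perm_lift H d \<pi>) W = is_component (perm_lift H d \<sigma>) W"
    if "\<And>e i. e \<in> arcs H \<Longrightarrow> i \<in> {1..d} \<Longrightarrow> \<pi> e i = \<sigma> e i" for \<pi> \<sigma> W
    using that by (simp add: is_component_def saturated_perm_lift_iff)
  have L: "\<sigma> \<in> ?L \<longleftrightarrow> \<sigma> \<in> ?P {1..n} \<and> (\<forall>e\<in>arcs H. \<sigma> e ` {1..d} = {1..d}) \<and>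
      is_component (perm_lift H d \<sigma>) (verts H \<times> {1..d})" for \<sigma>
    using is_component_initial_fibres[OF assms(1) _ assms(2)] by blast
  have "bij_betw (\<lambda>(\<pi>, \<rho>). \<lambda>e. \<pi> e \<circ> \<rho> e) (connected_lifts H d \<times> ?P {Suc d..n}) ?L"
  proof (rule bij_betw_byWitness[where f' = "\<lambda>\<sigma>. (r {1..d} \<sigma>, r {Suc d..n} \<sigma>)"]; safe)
    fix \<pi> \<rho> assume \<pi>: "\<pi> \<in> connected_lifts H d" and \<rho>: "\<rho> \<in> ?P {Suc d..n}"
    have \<pi>P: "\<pi> \<in> ?P {1..d}" using \<pi> by (simp add: connected_lifts_def)
    \<comment> \<open>The factors have disjoint supports, so composing them amounts to gluing them
      along the two blocks.\<close>
    have eq: "\<pi> e \<circ> \<rho> e = (\<lambda>i. if i \<in> {1..d} then \<pi> e i else \<rho> e i)" for e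
    proof
      fix i
      have "\<rho> e i = i" if "i \<in> {1..d}"
        using \<rho> that by (cases "e \<in> arcs H") (auto simp: perm_systems_iff permutes_def)
      moreover have "\<pi> e (\<rho> e i) = \<rho> e i" if "i \<notin> {1..d}"
      proof (cases "e \<in> arcs H")
        case True
        then have "\<rho> e i \<notin> {1..d}"
          using \<rho> that permutes_in_image[of "\<rho> e" "{Suc d..n}" i] permutes_not_in[of "\<rho> e" "{Suc d..n}" i]
          by (cases "i \<in> {Suc d..n}") (auto simp: perm_systems_iff)
        then show ?thesis
          using True \<pi>P by (auto simp: perm_systems_iff intro: permutes_not_in)
      qed (use \<pi>P in \<open>auto simp: perm_systems_iff\<close>)
      ultimately show "(\<pi> e \<circ> \<rho> e) i = (if i \<in> {1..d} then \<pi> e i else \<rho> e i)" by auto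
    qed
    have id1: "\<pi> e i = i" if "i \<notin> {1..d}" for e i
      using \<pi>P that by (cases "e \<in> arcs H") (auto simp: perm_systems_iff intro: permutes_not_in)
    have id2: "\<rho> e i = i" if "i \<notin> {Suc d..n}" for e i
      using \<rho> that by (cases "e \<in> arcs H") (auto simp: perm_systems_iff intro: permutes_not_in)
    show "r {1..d} (\<lambda>e. \<pi> e \<circ> \<rho> e) = \<pi>"
      unfolding eq using id1 by (auto simp: r_def fun_eq_iff)
    show "r {Suc d..n} (\<lambda>e. \<pi> e \<circ> \<rho> e) = \<rho>"
      unfolding eq using id2 by (auto simp: r_def fun_eq_iff)
    have "(\<lambda>e. \<pi> e \<circ> \<rho> e) \<in> ?P {1..n}"
      using \<pi>P \<rho> split unfolding perm_systems_iff
      by (auto intro!: permutes_compose intro: permutes_subset)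
    moreover have "(\<pi> e \<circ> \<rho> e) ` {1..d} = {1..d}" if "e \<in> arcs H" for e
    proof -
      have "(\<pi> e \<circ> \<rho> e) ` {1..d} = \<pi> e ` {1..d}"
        unfolding eq by (rule image_cong) auto
      then show ?thesis
        using \<pi>P that by (simp add: perm_systems_iff permutes_image)
    qed
    moreover have "is_component (perm_lift H d (\<lambda>e. \<pi> e \<circ> \<rho> e)) (verts H \<times> {1..d})"
      using \<pi> conn[OF \<pi>P] unfolding eq connected_lifts_def
      by (subst lift_cong[of _ \<pi>]) auto
    ultimately have "(\<lambda>e. \<pi> e \<circ> \<rho> e) \<in> ?L" unfolding L by blast
    then show "(\<lambda>e. \<pi> e \<circ> \<rho> e) \<in> ?P {1..n}"
      "is_component (perm_lift H n (\<lambda>e. \<pi> e \<circ> \<rho> e)) (verts H \<times> {1..d})" by auto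
  next
    fix \<sigma> assume *: "\<sigma> \<in> ?P {1..n}" "is_component (perm_lift H n \<sigma>) (verts H \<times> {1..d})"
    then have \<sigma>: "\<sigma> \<in> ?P {1..n}" "\<forall>e\<in>arcs H. \<sigma> e ` {1..d} = {1..d}"
        "is_component (perm_lift H d \<sigma>) (verts H \<times> {1..d})"
      using L by blast+
    have img: "\<sigma> e ` {Suc d..n} = {Suc d..n}" if "e \<in> arcs H" for e
    proof -
      have p: "\<sigma> e permutes {1..n}" using \<sigma> that by (simp add: perm_systems_iff)
      have "{Suc d..n} = {1..n} - {1..d}" by auto
      then have "\<sigma> e ` {Suc d..n} = \<sigma> e ` {1..n} - \<sigma> e ` {1..d}"
        by (simp add: image_set_diff[OF permutes_inj[OF p]])
      also have "\<dots> = {Suc d..n}"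
        using \<sigma>(2) that permutes_image[OF p] by auto
      finally show ?thesis .
    qed
    show r2: "r {Suc d..n} \<sigma> \<in> ?P {Suc d..n}"
      using restrict[OF \<sigma>(1)] img by blast
    have r1: "r {1..d} \<sigma> \<in> ?P {1..d}"
      using restrict[OF \<sigma>(1)] \<sigma>(2) by blast
    show "r {1..d} \<sigma> \<in> connected_lifts H d"
      using r1 conn[OF r1] lift_cong[of "r {1..d} \<sigma>" \<sigma>] \<sigma>(3)
      unfolding connected_lifts_def r_def by (simp cong: conj_cong)
    show "(\<lambda>e. r {1..d} \<sigma> e \<circ> r {Suc d..n} \<sigma> e) = \<sigma>"
    proof (intro ext)
      fix e i
      show "(r {1..d} \<sigma> e \<circ> r {Suc d..n} \<sigma> e) i = \<sigma> e i"
      proof (cases "e \<in> arcs H")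
        case True
        then have "\<sigma> e i \<in> {Suc d..n}" if "i \<in> {Suc d..n}"
          using img that by blast
        moreover have "\<sigma> e i = i" if "i \<notin> {1..n}"
          using \<sigma>(1) True that by (auto simp: perm_systems_iff intro: permutes_not_in)
        ultimately show ?thesis
          using assms(2) by (cases "i \<in> {1..d}"; cases "i \<in> {Suc d..n}") (auto simp: r_def)
      qed (use \<sigma>(1) in \<open>auto simp: r_def perm_systems_iff\<close>)
    qed
  qed
  then have "card ?L = card (connected_lifts H d \<times> ?P {Suc d..n})"
    by (simp add: bij_betw_same_card)
  then show ?thesis
    by (simp add: card_cartesian_product card_perm_systems)
qed

text \<open>Each lift is counted once, through the component of the point \<open>1\<close> over a
  fixed vertex \<open>v0\<close>. Its slice over \<open>v0\<close> is a \<open>d\<close>-set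
  containing \<open>1\<close>; the other \<open>card (verts H) - 1\<close> slices are arbitrary
  \<open>d\<close>-sets.\<close>

lemma card_lifts_by_component:
  assumes H: "fin_digraph H" "graph_connected H" and "n \<ge> 1"
  shows "fact n ^ card (arcs H) =
    (\<Sum>d = 1..n. ((n - 1) choose (d - 1)) * (n choose d) ^ (card (verts H) - 1) *
      (card (connected_lifts H d) * fact (n - d) ^ card (arcs H)))"
proof -
  interpret fin_digraph H by fact
  let ?P = "perm_systems (arcs H) {1..n}"
  obtain v0 where v0: "v0 \<in> verts H"
    using H(2) unfolding connected_iff_is_component[OF wf_digraph_axioms] is_component_def by blast
  \<comment> \<open>\<open>F d\<close> collects the possible families of slices, and
    \<open>B (d, S)\<close> the systems for which the family \<open>S\<close> is a
    component.\<close>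
  define F where "F d = PiE (verts H) (\<lambda>v. {X. X \<subseteq> {1..n} \<and> card X = d \<and> (v = v0 \<longrightarrow> 1 \<in> X)})" for d
  define B where "B = (\<lambda>(d :: nat, S). {\<pi> \<in> ?P. is_component (perm_lift H n \<pi>) (SIGMA v:verts H. S v)})"
  have finF: "finite (F d)" for d
    unfolding F_def by (rule finite_PiE) auto
  have cardF: "card (F d) = ((n - 1) choose (d - 1)) * (n choose d) ^ (card (verts H) - 1)"
    if "d \<ge> 1" for d
  proof -
    have "card (F d) = (\<Prod>v\<in>verts H. card {X. X \<subseteq> {1..n} \<and> card X = d \<and> (v = v0 \<longrightarrow> 1 \<in> X)})"
      unfolding F_def by (rule card_PiE) simp
    also have "\<dots> = card {X. X \<subseteq> {1..n} \<and> card X = d \<and> 1 \<in> X} *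
        (\<Prod>v\<in>verts H - {v0}. card {X. X \<subseteq> {1..n} \<and> card X = d})"
      by (subst prod.remove[OF _ v0]) (auto intro!: arg_cong2[where f = "(*)"] prod.cong)
    also have "(\<Prod>v\<in>verts H - {v0}. card {X. X \<subseteq> {1..n} \<and> card X = d}) = (n choose d) ^ (card (verts H) - 1)"
      using v0 by (simp add: n_subsets)
    also have "card {X. X \<subseteq> {1..n} \<and> card X = d \<and> 1 \<in> X} = (n - 1) choose (d - 1)"
      using card_subsets_containing[of "{1..n}" 1 d] that \<open>n \<ge> 1\<close> by simp
    finally show ?thesis .
  qed
  have cardB: "card (B (d, S)) = card (connected_lifts H d) * fact (n - d) ^ card (arcs H)"
    if d: "d \<in> {1..n}" and S: "S \<in> F d" for d S
  proof -
    \<comment> \<open>Renumbering the fibres moves every slice to \<open>{1..d}\<close>, so the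
      count depends on \<open>d\<close> only.\<close>
    have "\<exists>g. g permutes {1..n} \<and> g ` {1..d} = S v" if "v \<in> verts H" for v
    proof -
      have "S v \<subseteq> {1..n}" "card (S v) = d"
        using S that by (auto simp: F_def PiE_iff)
      then show ?thesis
        using d by (intro ex_permutes_image_eq) auto
    qed
    then obtain g where g: "\<And>v. v \<in> verts H \<Longrightarrow> g v permutes {1..n}"
        "\<And>v. v \<in> verts H \<Longrightarrow> g v ` {1..d} = S v"
      by metis
    have "(SIGMA v:verts H. S v) = (\<lambda>(v, i). (v, g v i)) ` (verts H \<times> {1..d})"
      using g(2) by (simp add: image_fibrewise cong: Sigma_cong)
    then have "card (B (d, S)) =
        card {\<pi> \<in> ?P. is_component (perm_lift H n \<pi>) ((\<lambda>(v, i). (v, g v i)) ` (verts H \<times> {1..d}))}"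
      by (simp add: B_def)
    also have "\<dots> = card {\<pi> \<in> ?P. is_component (perm_lift H n \<pi>) (verts H \<times> {1..d})}"
      using d by (intro card_component_systems_conjugate[OF H(1) g(1)]) auto
    also have "\<dots> = card (connected_lifts H d) * fact (n - d) ^ card (arcs H)"
      using d by (intro card_initial_component_systems[OF H(1)]) auto
    finally show ?thesis .
  qed
  have cover: "?P = (\<Union>x\<in>(SIGMA d:{1..n}. F d). B x)"
  proof (intro equalityI subsetI)
    fix \<pi> assume \<pi>: "\<pi> \<in> ?P"
    have "(v0, 1) \<in> verts (perm_lift H n \<pi>)"
      using v0 \<open>n \<ge> 1\<close> by (auto simp: perm_lift_def)
    then obtain W where W: "is_component (perm_lift H n \<pi>) W" "(v0, 1) \<in> W"
      using ex1_is_component[OF wf_perm_lift[OF H(1) \<pi>]] by blast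
    then have sat: "saturated (perm_lift H n \<pi>) W" and sub: "W \<subseteq> verts H \<times> {1..n}"
      by (auto simp: is_component_def saturated_perm_lift_iff)
    \<comment> \<open>The restriction to \<open>verts H\<close> is needed for membership in
      \<open>F\<close>, whose elements are extensional functions.\<close>
    define S where "S = (\<lambda>v\<in>verts H. W `` {v})"
    have W_eq: "(SIGMA v:verts H. S v) = W"
      using sub by (auto simp: S_def)
    have slice: "W `` {v0} \<subseteq> {1..n}"
      using sub by blast
    then have fin: "finite (W `` {v0})"
      by (rule finite_subset) simp
    have "card (W `` {v0}) \<le> card {1..n}"
      using slice by (intro card_mono) simp_all
    moreover have "card (W `` {v0}) \<ge> 1"
      using fin W(2) by (auto simp: Suc_le_eq card_gt_0_iff)
    ultimately have "card (W `` {v0}) \<in> {1..n}" by simp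
    moreover have "S \<in> F (card (W `` {v0}))"
      using sub W(2) card_slice_eq[OF H \<pi> sat v0] by (auto simp: F_def S_def)
    ultimately show "\<pi> \<in> (\<Union>x\<in>(SIGMA d:{1..n}. F d). B x)"
      using W(1) \<pi> W_eq unfolding B_def by (intro UN_I[of "(card (W `` {v0}), S)"]) auto
  qed (auto simp: B_def)
  \<comment> \<open>Two families realised by the same lift are both the component through
    \<open>(v0, 1)\<close>; its slices determine \<open>S\<close>, and their size determines
    \<open>d\<close>.\<close>
  have disj: "B x \<inter> B y = {}"
    if xy: "x \<in> (SIGMA d:{1..n}. F d)" "y \<in> (SIGMA d:{1..n}. F d)" "x \<noteq> y" for x y
  proof (rule ccontr)
    assume "B x \<inter> B y \<noteq> {}"
    then obtain \<pi> where \<pi>: "\<pi> \<in> B x" "\<pi> \<in> B y" by blast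
    obtain d S d' S' where eq: "x = (d, S)" "y = (d', S')" by (metis surj_pair)
    have S: "S \<in> F d" "S' \<in> F d'" using xy eq by auto
    have in1: "(v0, 1) \<in> (SIGMA v:verts H. S v)" "(v0, 1) \<in> (SIGMA v:verts H. S' v)"
      using S v0 by (auto simp: F_def PiE_iff)
    moreover have "(v0, 1) \<in> verts (perm_lift H n \<pi>)"
      using v0 \<open>n \<ge> 1\<close> by (auto simp: perm_lift_def)
    ultimately have "(SIGMA v:verts H. S v) = (SIGMA v:verts H. S' v)"
      using ex1_is_component[OF wf_perm_lift[OF H(1)], of \<pi> n "(v0, 1)"] \<pi> eq
      unfolding B_def by blast
    then have "S v = S' v" if "v \<in> verts H" for v
      using that by blast
    moreover have "S v = S' v" if "v \<notin> verts H" for v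
      using that S by (simp add: F_def PiE_iff extensional_def)
    ultimately have "S = S'" by blast
    moreover have "d = card (S v0)" "d' = card (S' v0)"
      using S v0 by (auto simp: F_def PiE_iff)
    ultimately show False using xy eq by simp
  qed
  have "fact n ^ card (arcs H) = card ?P"
    by (simp add: card_perm_systems)
  also have "\<dots> = (\<Sum>x\<in>(SIGMA d:{1..n}. F d). card (B x))"
    unfolding cover
  proof (rule card_UN_disjoint)
    have "finite ?P" by (simp add: finite_perm_systems)
    then show "\<forall>x\<in>(SIGMA d:{1..n}. F d). finite (B x)"
      by (auto simp: B_def)
  qed (use finF disj in auto)
  also have "\<dots> = (\<Sum>d = 1..n. \<Sum>S\<in>F d. card (B (d, S)))"
    using finF by (subst sum.Sigma) auto
  also have "\<dots> = (\<Sum>d = 1..n. card (F d) * (card (connected_lifts H d) * fact (n - d) ^ card (arcs H)))"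
    using cardB by (intro sum.cong) auto
  also have "\<dots> = (\<Sum>d = 1..n. ((n - 1) choose (d - 1)) * (n choose d) ^ (card (verts H) - 1) *
      (card (connected_lifts H d) * fact (n - d) ^ card (arcs H)))"
    using cardF by (intro sum.cong) auto
  finally show ?thesis .
qed

section \<open>The recursion for the connection probability\<close>

text \<open>The count by components, divided by \<open>fact n ^ card (arcs H)\<close> and solved for
  its term \<open>d = n\<close>, whose coefficient is \<open>1\<close>. Here \<open>r\<close> stands
  for the excess of arcs over vertices.\<close>

fun lift_conn_prob :: "nat \<Rightarrow> nat \<Rightarrow> real" where
  "lift_conn_prob r n =
     1 - (\<Sum>d = 1..<n. real d / real n * (1 / real (n choose d)) ^ r * lift_conn_prob r d)"

declare lift_conn_prob.simps [simp del]

section \<open>Sums of reciprocal binomial coefficients\<close>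

text \<open>Binomial coefficients increase up to the middle; an index beyond the middle is reflected
  to \<open>n - d\<close>.\<close>

lemma binomial_ge_inner:
  assumes "j \<le> d" "d \<le> n - j" "2 * j \<le> n"
  shows "n choose j \<le> n choose d"
proof (cases "2 * d \<le> n")
  case True
  then show ?thesis using assms by (intro binomial_mono) auto
next
  case False
  then have "n choose j \<le> n choose (n - d)"
    using assms by (intro binomial_mono) auto
  then show ?thesis using False assms by (simp add: binomial_symmetric[of d n])
qed

lemma real_choose_2: "real (n choose 2) = real n * (real n - 1) / 2"
proof (cases "n = 0")
  case False
  have "2 * (n choose 2) = n * (n - 1)"
    using times_binomial_minus1_eq[of 2 n] by simp
  then have "2 * real (n choose 2) = real n * real (n - 1)"
    by (metis of_nat_mult of_nat_numeral)
  then show ?thesis using False by (simp add: of_nat_diff)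
qed simp

lemma real_choose_3: "real (n choose 3) = real n * (real n - 1) * (real n - 2) / 6"
proof (cases "n = 0")
  case False
  have "3 * (n choose 3) = n * ((n - 1) choose 2)"
    using times_binomial_minus1_eq[of 3 n] by simp
  then have "3 * real (n choose 3) = real n * real ((n - 1) choose 2)"
    by (metis of_nat_mult of_nat_numeral)
  then show ?thesis using False by (simp add: real_choose_2 of_nat_diff field_simps)
qed simp

text \<open>The outermost terms equal \<open>1 / (n choose 2)\<close>. The fewer than
  \<open>n - 2\<close> others are each at most \<open>1 / (n choose 3)\<close>, so both groups are
  of order \<open>1 / n ^ 2\<close>.\<close>

lemma sum_inverse_binomial_inner:
  assumes "n \<ge> 4"
  shows "(\<Sum>d = 2..n - 2. 1 / real (n choose d)) \<le> 20 / real n ^ 2"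
proof -
  have n: "real n \<ge> 4" using assms by simp
  have choose2: "1 / real (n choose d) \<le> 2 / (real n * (real n - 1))" if "d \<in> {2, n - 2}" for d
  proof -
    have "n choose d = n choose 2"
      using that assms binomial_symmetric[of 2 n] by auto
    then show ?thesis by (simp add: real_choose_2)
  qed
  have choose3: "1 / real (n choose d) \<le> 6 / (real n * (real n - 1) * (real n - 2))"
    if "d \<in> {3..n - 3}" for d
  proof -
    have "n choose 3 \<le> n choose d"
      using that by (intro binomial_ge_inner) auto
    moreover have "real (n choose 3) > 0"
      using n by (simp add: real_choose_3)
    ultimately have "1 / real (n choose d) \<le> 1 / real (n choose 3)"
      using that by (intro divide_left_mono) (auto simp: zero_less_mult_iff)
    then show ?thesis by (simp add: real_choose_3)
  qed
  have "(\<Sum>d = 2..n - 2. 1 / real (n choose d)) \<le> (\<Sum>d\<in>{2, n - 2} \<union> {3..n - 3}. 1 / real (n choose d))"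
    using assms by (intro sum_mono2) auto
  also have "\<dots> \<le> (\<Sum>d\<in>{2, n - 2}. 1 / real (n choose d)) + (\<Sum>d = 3..n - 3. 1 / real (n choose d))"
    by (subst sum.union_inter[symmetric]) (auto intro!: sum_nonneg)
  also have "(\<Sum>d\<in>{2, n - 2}. 1 / real (n choose d)) \<le> real (card {2, n - 2}) * (2 / (real n * (real n - 1)))"
    by (rule sum_bounded_above) (rule choose2)
  \<comment> \<open>For \<open>n = 4\<close> the indices \<open>2\<close> and \<open>n - 2\<close>
    coincide, so their number is only bounded by \<open>2\<close>.\<close>
  also have "\<dots> \<le> 2 * (2 / (real n * (real n - 1)))"
    using n by (intro mult_right_mono) (auto simp: card_insert_if)
  also have "(\<Sum>d = 3..n - 3. 1 / real (n choose d)) \<le> real (card {3..n - 3}) * (6 / (real n * (real n - 1) * (real n - 2)))"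
    by (rule sum_bounded_above) (rule choose3)
  \<comment> \<open>The crude count \<open>n - 2\<close> cancels the last factor of the
    denominator.\<close>
  also have "\<dots> \<le> (real n - 2) * (6 / (real n * (real n - 1) * (real n - 2)))"
    using n assms by (intro mult_right_mono) auto
  also have "\<dots> = 6 / (real n * (real n - 1))"
    using n by (simp add: divide_simps)
  also have "2 * (2 / (real n * (real n - 1))) + 6 / (real n * (real n - 1)) = 10 / (real n * (real n - 1))"
    by (simp add: field_simps)
  also have "\<dots> \<le> 10 / (real n * (real n / 2))"
    using n by (intro divide_left_mono mult_left_mono) auto
  also have "\<dots> = 20 / real n ^ 2"
    by (simp add: power2_eq_square)
  finally show ?thesis by simp
qed

lemma sum_split_ends:
  fixes f :: "nat \<Rightarrow> real"
  assumes "n \<ge> 4"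
  shows "(\<Sum>d = 1..<n. f d) = f 1 + f (n - 1) + (\<Sum>d = 2..n - 2. f d)"
proof -
  have "{1..<n} = insert 1 (insert (n - 1) {2..n - 2})" using assms by auto
  moreover have "1 \<notin> insert (n - 1) {2..n - 2}" "n - 1 \<notin> {2..n - 2}" using assms by auto
  ultimately show ?thesis by (simp del: One_nat_def)
qed

text \<open>For \<open>n \<ge> 4\<close> the constant is \<open>2 + 5\<close>: the ends
  \<open>d = 1\<close> and \<open>d = n - 1\<close> give \<open>2 / n\<close>, and the inner bound
  \<open>20 / n ^ 2\<close> is at most \<open>5 / n\<close>.\<close>

lemma sum_inverse_binomial:
  assumes "n \<ge> 1"
  shows "(\<Sum>d = 1..<n. 1 / real (n choose d)) \<le> 7 / real n"
proof (cases "n \<ge> 4")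
  case True
  have "n choose (n - 1) = n"
    using True binomial_symmetric[of 1 n] by simp
  then have "(\<Sum>d = 1..<n. 1 / real (n choose d)) \<le> 2 / real n + 20 / real n ^ 2"
    using sum_inverse_binomial_inner[OF True] unfolding sum_split_ends[OF True] by simp
  also have "20 / real n ^ 2 \<le> 5 / real n"
    using True by (simp add: field_simps power2_eq_square)
  finally show ?thesis by simp
next
  case False
  then have "n = 1 \<or> n = 2 \<or> n = 3" using assms by auto
  then show ?thesis by (auto simp: numeral_2_eq_2 numeral_3_eq_3)
qed

lemma binomial_ge_self:
  assumes "1 \<le> d" "d < n"
  shows "n \<le> n choose d"
  using binomial_ge_inner[of 1 d n] assms by simp

section \<open>Bounds and asymptotics from the recursion\<close>

text \<open>Since \<open>r \<ge> 1\<close> and \<open>n choose d \<ge> n\<close> for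
  \<open>0 < d < n\<close>, each of the \<open>n - 1\<close> terms of the recursion lies between
  \<open>0\<close> and \<open>1 / n\<close>. Arguing from the recursion avoids exhibiting a graph of
  excess \<open>r\<close>.\<close>

lemma lift_conn_prob_bounds:
  assumes "r \<ge> 1" "n \<ge> 1"
  shows "0 \<le> lift_conn_prob r n \<and> lift_conn_prob r n \<le> 1"
  using assms(2)
proof (induction n rule: less_induct)
  case (less n)
  let ?f = "\<lambda>d. real d / real n * (1 / real (n choose d)) ^ r * lift_conn_prob r d"
  have IH: "0 \<le> lift_conn_prob r d" "lift_conn_prob r d \<le> 1" if "d \<in> {1..<n}" for d
    using less.IH[of d] that by auto
  have "?f d \<le> 1 * (1 / real n) * 1" if d: "d \<in> {1..<n}" for d
  proof (intro mult_mono)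
    have ge: "real n \<le> real (n choose d)"
      using d binomial_ge_self[of d n] by simp
    have "(1 / real (n choose d)) ^ r \<le> (1 / real (n choose d)) ^ 1"
      using assms d by (intro power_decreasing) (auto simp: field_simps Suc_le_eq)
    also have "\<dots> \<le> 1 / real n"
      using ge d by (simp add: field_simps)
    finally show "(1 / real (n choose d)) ^ r \<le> 1 / real n" .
  qed (use d IH in auto)
  then have "sum ?f {1..<n} \<le> real (card {1..<n}) * (1 * (1 / real n) * 1)"
    by (rule sum_bounded_above)
  also have "\<dots> \<le> 1" using less.prems by (simp add: field_simps)
  finally have "sum ?f {1..<n} \<le> 1" .
  moreover have "sum ?f {1..<n} \<ge> 0"
    using IH by (intro sum_nonneg) auto
  ultimately show ?case by (subst (1 2) lift_conn_prob.simps) auto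
qed

text \<open>A first bound, uniform in \<open>r\<close>; it controls the value at
  \<open>n - 1\<close> in \<open>lift_conn_prob_approx\<close>.\<close>

lemma one_minus_lift_conn_prob_le:
  assumes "r \<ge> 1" "n \<ge> 1"
  shows "1 - lift_conn_prob r n \<le> 7 / real n"
proof -
  have "(\<Sum>d = 1..<n. real d / real n * (1 / real (n choose d)) ^ r * lift_conn_prob r d)
      \<le> (\<Sum>d = 1..<n. 1 * (1 / real (n choose d)) ^ 1 * 1)"
    using lift_conn_prob_bounds assms
    by (intro sum_mono mult_mono power_decreasing) (auto simp: field_simps Suc_le_eq)
  also have "\<dots> \<le> 7 / real n"
    using sum_inverse_binomial[OF assms(2)] by simp
  finally show ?thesis by (subst lift_conn_prob.simps) simp
qed

text \<open>By induction every term of the sum is \<open>(d / n) / d = 1 / n\<close>, and there are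
  \<open>n - 1\<close> of them.\<close>

lemma lift_conn_prob_0:
  assumes "n \<ge> 1"
  shows "lift_conn_prob 0 n = 1 / real n"
  using assms
proof (induction n rule: less_induct)
  case (less n)
  have "(\<Sum>d = 1..<n. real d / real n * (1 / real (n choose d)) ^ 0 * lift_conn_prob 0 d) =
      (\<Sum>d = 1..<n. 1 / real n)"
    using less.IH by (intro sum.cong) auto
  also have "\<dots> = 1 - 1 / real n"
    using less.prems by (simp add: field_simps of_nat_diff)
  finally show ?case by (subst lift_conn_prob.simps) simp
qed

text \<open>For \<open>r \<ge> 1\<close> and \<open>n \<ge> 4\<close>, the constant is
  \<open>7 + 20\<close>: \<open>7\<close> from the defect of the value at \<open>n - 1\<close>,
  \<open>20\<close> from the inner terms of the sum. The cases \<open>r = 0\<close> and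
  \<open>n \<le> 3\<close> are treated directly.\<close>

lemma lift_conn_prob_approx:
  assumes "n \<ge> 1"
  shows "\<bar>lift_conn_prob r n - 1 + 1 / real n ^ r\<bar> \<le> 27 * (1 / real n ^ (r + 1))"
proof -
  let ?f = "\<lambda>d. real d / real n * (1 / real (n choose d)) ^ r * lift_conn_prob r d"
  have one: "lift_conn_prob r (Suc 0) = 1"
    by (subst lift_conn_prob.simps) simp
  consider "r = 0" | "r \<ge> 1" "n = 1" | "r \<ge> 1" "n = 2" | "r \<ge> 1" "n = 3" | "r \<ge> 1" "n \<ge> 4"
    using assms by linarith
  then show ?thesis
  proof cases
    case 1
    then show ?thesis using assms by (simp add: lift_conn_prob_0 divide_right_mono)
  next
    case 2
    then show ?thesis by (simp add: one)
  next
    case 3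
    have "{1..<2::nat} = {1}" by auto
    then have "lift_conn_prob r 2 = 1 - 1 / 2 * (1 / 2) ^ r"
      by (subst lift_conn_prob.simps) (simp add: one)
    then show ?thesis using 3 by (simp add: power_divide divide_right_mono)
  next
    case 4
    have "{1..<3::nat} = {1, 2}" by auto
    moreover have "(3::nat) choose 2 = 3" by (simp add: numeral_2_eq_2 numeral_3_eq_3)
    ultimately have "lift_conn_prob r 3 = 1 - (1 / 3 * (1 / 3) ^ r + 2 / 3 * (1 / 3) ^ r * lift_conn_prob r 2)"
      by (subst lift_conn_prob.simps) (simp add: one)
    \<comment> \<open>The weights \<open>1 / 3\<close> and \<open>2 / 3\<close> add up to
      \<open>1\<close>, so only the defect of \<open>lift_conn_prob r 2\<close> survives.\<close>
    then have "lift_conn_prob r 3 - 1 + 1 / 3 ^ r = 2 / 3 * (1 / 3) ^ r * (1 - lift_conn_prob r 2)"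
      unfolding power_one_over[symmetric] by (simp add: algebra_simps)
    also have "\<bar>\<dots>\<bar> = 2 / 3 * (1 / 3) ^ r * \<bar>1 - lift_conn_prob r 2\<bar>"
      by (simp add: abs_mult)
    also have "\<dots> \<le> 2 / 3 * (1 / 3) ^ r * 1"
      using lift_conn_prob_bounds[of r 2] 4 by (intro mult_left_mono) auto
    also have "\<dots> \<le> 27 * (1 / 3 ^ (r + 1))" by (simp add: power_divide field_simps)
    finally show ?thesis using 4 by simp
  next
    case 5
    have n: "real n \<ge> 4" using 5 by simp
    define m where "m = n - 1"
    have m: "m \<ge> 1" "real m = real n - 1" using 5 by (auto simp: m_def)
    \<comment> \<open>To be used with \<open>X = (1 / n) ^ r\<close>, \<open>a = 1 / n\<close>,
      \<open>b = m / n\<close>, \<open>p\<close> the value at \<open>m = n - 1\<close> and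
      \<open>S\<close> the inner sum: as \<open>a + b = 1\<close>, the end terms cancel the main
      term \<open>X\<close> up to the defect of \<open>p\<close>.\<close>
    have rearrange: "L - 1 + X = X * (b * (1 - p)) - S"
      if "L = 1 - (a * X + b * X * p + S)" "b = 1 - a" for L X a b p S :: real
      unfolding that by (simp add: algebra_simps)
    have "n choose m = n" using binomial_symmetric[of 1 n] 5 by (simp add: m_def)
    then have "lift_conn_prob r n = 1 - (1 / real n * (1 / real n) ^ r
        + real m / real n * (1 / real n) ^ r * lift_conn_prob r m + (\<Sum>d = 2..n - 2. ?f d))"
      by (subst lift_conn_prob.simps, subst sum_split_ends[OF 5(2)]) (simp add: one m_def)
    moreover have "real m / real n = 1 - 1 / real n"
      using n m(2) by (simp add: field_simps)
    ultimately have eq: "lift_conn_prob r n - 1 + 1 / real n ^ r =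
        (1 / real n) ^ r * (real m / real n * (1 - lift_conn_prob r m)) - (\<Sum>d = 2..n - 2. ?f d)"
      unfolding power_one_over[symmetric] by (rule rearrange)
    have "real m / real n * (1 - lift_conn_prob r m) \<le> real m / real n * (7 / real m)"
      using one_minus_lift_conn_prob_le[of r m] 5 m by (intro mult_left_mono) auto
    also have "\<dots> = 7 / real n" using m(1) by simp
    finally have up: "(1 / real n) ^ r * (real m / real n * (1 - lift_conn_prob r m)) \<le> (1 / real n) ^ r * (7 / real n)"
      by (intro mult_left_mono) auto
    have low: "(1 / real n) ^ r * (real m / real n * (1 - lift_conn_prob r m)) \<ge> 0"
      using lift_conn_prob_bounds[of r m] 5 m by auto
    have "(\<Sum>d = 2..n - 2. ?f d) \<le> (\<Sum>d = 2..n - 2. (1 / real n) ^ r * real n * (1 / real (n choose d)))"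
    proof (rule sum_mono)
      fix d assume d: "d \<in> {2..n - 2}"
      then have dn: "1 \<le> d" "d < n" using 5 by auto
      have ge: "real n \<le> real (n choose d)"
        using dn by (simp add: binomial_ge_self)
      have "?f d \<le> 1 * (1 / real (n choose d)) ^ r * 1"
        using lift_conn_prob_bounds[of r d] dn 5 by (intro mult_mono) auto
      also have "\<dots> = (1 / real n) ^ r * (real n / real (n choose d)) ^ r"
        using n by (simp add: power_divide)
      \<comment> \<open>The ratio is at most \<open>1\<close> and \<open>r \<ge> 1\<close>, so its
        power is bounded by the ratio itself; this keeps the estimate uniform in
        \<open>r\<close>.\<close>
      also have "(real n / real (n choose d)) ^ r \<le> (real n / real (n choose d)) ^ 1"
        using ge n 5 by (intro power_decreasing) (auto simp: divide_le_eq_1)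
      finally show "?f d \<le> (1 / real n) ^ r * real n * (1 / real (n choose d))"
        using n by (simp add: mult_left_mono)
    qed
    also have "\<dots> = (1 / real n) ^ r * real n * (\<Sum>d = 2..n - 2. 1 / real (n choose d))"
      by (simp add: sum_distrib_left)
    also have "\<dots> \<le> (1 / real n) ^ r * real n * (20 / real n ^ 2)"
      using sum_inverse_binomial_inner[OF 5(2)] by (intro mult_left_mono) auto
    also have "\<dots> = (1 / real n) ^ r * (20 / real n)"
      using n by (simp add: power2_eq_square)
    finally have up2: "(\<Sum>d = 2..n - 2. ?f d) \<le> (1 / real n) ^ r * (20 / real n)" .
    have low2: "(\<Sum>d = 2..n - 2. ?f d) \<ge> 0"
      using lift_conn_prob_bounds[of r] 5 by (intro sum_nonneg) auto
    have "(1 / real n) ^ r * (7 / real n) + (1 / real n) ^ r * (20 / real n) = 27 * (1 / real n ^ (r + 1))"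
      by (simp add: power_divide field_simps)
    moreover have "(1 / real n) ^ r * (7 / real n) \<ge> 0" "(1 / real n) ^ r * (20 / real n) \<ge> 0"
      by simp_all
    ultimately show ?thesis
      unfolding eq using up low up2 low2 by linarith
  qed
qed

section \<open>From counting to probabilities\<close>

text \<open>Independent uniform permutations on the arcs form a uniform element of
  \<open>perm_systems\<close>.\<close>

lemma prob_random_lift_connected_eq_card:
  assumes "fin_digraph H"
  shows "measure_pmf.prob (random_lift H n) {K. graph_connected K} =
    card (connected_lifts H n) / fact n ^ card (arcs H)"
proof -
  interpret fin_digraph H by fact
  have "Pi_pmf (arcs H) id (\<lambda>_. pmf_of_set {p. p permutes {1..n}}) =
      pmf_of_set (perm_systems (arcs H) {1..n})"
    unfolding perm_systems_def
    by (rule Pi_pmf_of_set) (auto simp: finite_permutations intro: permutes_id)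
  moreover have "id \<in> {p. p permutes {1..n}}" by (simp add: permutes_id)
  moreover have "(\<lambda>_. id) \<in> perm_systems (arcs H) {1..n}"
    by (simp add: perm_systems_iff permutes_id)
  ultimately show ?thesis
    by (subst random_lift_def, simp only: measure_map_pmf, subst measure_pmf_of_set)
      (auto simp: finite_perm_systems card_perm_systems connected_lifts_def
        intro!: arg_cong2[where f = "(/)"] arg_cong[where f = real] arg_cong[where f = card])
qed

text \<open>The count by components, divided by the number of all systems, is the recursion of
  \<open>lift_conn_prob\<close>; strong induction identifies the solutions.\<close>

lemma prob_random_lift_connected:
  assumes H: "fin_digraph H" "graph_connected H"
    and r: "card (arcs H) = card (verts H) + r" and "n \<ge> 1"
  shows "measure_pmf.prob (random_lift H n) {K. graph_connected K} = lift_conn_prob r n"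
  using \<open>n \<ge> 1\<close>
proof (induction n rule: less_induct)
  case (less n)
  interpret fin_digraph H by fact
  define p where "p d = measure_pmf.prob (random_lift H d) {K. graph_connected K}" for d
  have p: "real (card (connected_lifts H d)) = p d * fact d ^ card (arcs H)" for d
    using prob_random_lift_connected_eq_card[OF H(1)] by (simp add: p_def)
  have V: "card (verts H) \<ge> 1"
    using H(2) unfolding connected_iff_is_component[OF wf_digraph_axioms] is_component_def
    by (simp add: Suc_le_eq card_gt_0_iff)
  have "real (fact n ^ card (arcs H)) = (\<Sum>d = 1..n. fact n ^ card (arcs H) *
      (real d / real n * (1 / real (n choose d)) ^ r * p d))"
    unfolding card_lifts_by_component[OF H less.prems] of_nat_sum
  proof (rule sum.cong)
    fix d assume d: "d \<in> {1..n}"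
    define C where "C = real (n choose d)"
    have C: "C > 0" using d by (simp add: C_def)
    \<comment> \<open>The absorption identity, which produces the weight
      \<open>d / n\<close>.\<close>
    have "d * (n choose d) = n * ((n - 1) choose (d - 1))"
      using d by (intro times_binomial_minus1_eq) auto
    then have "real d * C = real n * real ((n - 1) choose (d - 1))"
      unfolding C_def by (metis of_nat_mult)
    then have 1: "real ((n - 1) choose (d - 1)) = real d / real n * C"
      using d by (simp add: field_simps)
    have "fact d * fact (n - d) * C = fact n"
      using d binomial_fact[of d n, where 'a = real] by (simp add: C_def)
    then have 2: "fact n ^ card (arcs H) = (fact d ^ card (arcs H) * fact (n - d) ^ card (arcs H) * C ^ card (arcs H) :: real)"
      by (metis power_mult_distrib)
    \<comment> \<open>The exponent splits as \<open>1 + (card (verts H) - 1) + r\<close>, where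
      \<open>V\<close> justifies the natural subtraction. The choices of slices thus cancel all but
      \<open>r\<close> of the factors \<open>C\<close>, one per arc.\<close>
    have "C ^ card (arcs H) = C * C ^ (card (verts H) - 1) * C ^ r"
      using V r by (simp flip: power_Suc power_add)
    then have 3: "C ^ card (arcs H) * (1 / C) ^ r = C * C ^ (card (verts H) - 1)"
      using C by (simp add: power_divide)
    have "real ((n - 1 choose (d - 1)) * (n choose d) ^ (card (verts H) - 1) *
        (card (connected_lifts H d) * fact (n - d) ^ card (arcs H))) =
        real d / real n * C * C ^ (card (verts H) - 1) * (p d * fact d ^ card (arcs H) * fact (n - d) ^ card (arcs H))"
      by (simp only: of_nat_mult of_nat_power p 1 C_def of_nat_fact)
    also have "\<dots> = real d / real n * (C ^ card (arcs H) * (1 / C) ^ r) * (p d * fact d ^ card (arcs H) * fact (n - d) ^ card (arcs H))"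
      unfolding 3 by (simp only: mult.assoc)
    also have "\<dots> = fact n ^ card (arcs H) * (real d / real n * (1 / C) ^ r * p d)"
      unfolding 2 by (simp only: mult_ac)
    finally show "real ((n - 1 choose (d - 1)) * (n choose d) ^ (card (verts H) - 1) *
        (card (connected_lifts H d) * fact (n - d) ^ card (arcs H))) =
        fact n ^ card (arcs H) * (real d / real n * (1 / real (n choose d)) ^ r * p d)"
      by (simp only: C_def)
  qed simp
  then have "fact n ^ card (arcs H) = fact n ^ card (arcs H) *
      (\<Sum>d = 1..n. real d / real n * (1 / real (n choose d)) ^ r * p d)"
    by (simp only: sum_distrib_left of_nat_power of_nat_fact)
  then have "1 = (\<Sum>d = 1..n. real d / real n * (1 / real (n choose d)) ^ r * p d)"
    by simp
  \<comment> \<open>The term \<open>d = n\<close> has coefficient \<open>1\<close> and is split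
    off.\<close>
  also have "{1..n} = insert n {1..<n}" using less.prems by auto
  also have "(\<Sum>d\<in>insert n {1..<n}. real d / real n * (1 / real (n choose d)) ^ r * p d) =
      p n + (\<Sum>d = 1..<n. real d / real n * (1 / real (n choose d)) ^ r * p d)"
    using less.prems by simp
  also have "(\<Sum>d = 1..<n. real d / real n * (1 / real (n choose d)) ^ r * p d) =
      (\<Sum>d = 1..<n. real d / real n * (1 / real (n choose d)) ^ r * lift_conn_prob r d)"
    using less.IH by (intro sum.cong) (auto simp: p_def)
  finally show ?case
    unfolding p_def by (subst lift_conn_prob.simps) linarith
qed

section \<open>Iterated lifts\<close>

lemma inj_on_push_label: "inj_on push_label A"
  by (auto simp: inj_on_def push_label_def)

lemma inj_on_root_label: "inj_on root_label A"
  by (auto simp: inj_on_def root_label_def)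

lemma set_pmf_random_lift:
  assumes "fin_digraph H"
  shows "set_pmf (random_lift H n) = perm_lift H n ` perm_systems (arcs H) {1..n}"
proof -
  interpret fin_digraph H by fact
  have "{p. p permutes {1..n}} \<noteq> {}" using permutes_id by blast
  then show ?thesis
    by (simp add: random_lift_def set_Pi_pmf perm_systems_def finite_permutations o_def)
qed

text \<open>Vertices and arcs are multiplied by the same factor, so every outcome at level
  \<open>k\<close> has the same excess. This makes the next factor independent of the
  outcome.\<close>

lemma set_pmf_iterated_random_lift:
  assumes "fin_digraph G" "H \<in> set_pmf (iterated_random_lift G n k)"
  shows "fin_digraph H \<and> card (verts H) = card (verts G) * (\<Prod>j = 1..k. n j) \<and>
    card (arcs H) = card (arcs G) * (\<Prod>j = 1..k. n j)"
  using assms(2)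
proof (induction k arbitrary: H)
  case 0
  then have H: "H = relabel root_label root_label G" by simp
  have "fin_digraph H"
    unfolding H by (rule fin_digraph_relabel[OF assms(1) inj_on_root_label])
  then show ?case
    by (simp add: H relabel_def card_image inj_on_root_label)
next
  case (Suc k)
  then obtain K \<pi> where K: "K \<in> set_pmf (iterated_random_lift G n k)"
    and H: "H = relabel push_label push_label (perm_lift K (n (Suc k)) \<pi>)"
    and \<pi>: "\<pi> \<in> perm_systems (arcs K) {1..n (Suc k)}"
  proof -
    have "H \<in> (\<Union>K\<in>set_pmf (iterated_random_lift G n k).
        relabel push_label push_label ` set_pmf (random_lift K (n (Suc k))))"
      using Suc.prems by simp
    then obtain K K' where *: "K \<in> set_pmf (iterated_random_lift G n k)"
      "K' \<in> set_pmf (random_lift K (n (Suc k)))" "H = relabel push_label push_label K'"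
      by blast
    moreover have "fin_digraph K" using Suc.IH[OF *(1)] by blast
    ultimately show ?thesis
      using that by (auto simp: set_pmf_random_lift)
  qed
  have K': "fin_digraph K" "card (verts K) = card (verts G) * (\<Prod>j = 1..k. n j)"
    "card (arcs K) = card (arcs G) * (\<Prod>j = 1..k. n j)"
    using Suc.IH[OF K] by auto
  have "fin_digraph (perm_lift K (n (Suc k)) \<pi>)"
    using fin_digraph_perm_lift[OF K'(1)] \<pi> by (simp add: perm_systems_iff)
  then have "fin_digraph H"
    unfolding H by (rule fin_digraph_relabel[OF _ inj_on_push_label])
  then show ?case
    using K' by (simp add: H relabel_def perm_lift_def card_image inj_on_push_label card_cartesian_product)
qed

lemma prob_bind_pmf:
  "measure_pmf.prob (bind_pmf M f) A = (\<integral>x. measure_pmf.prob (f x) A \<partial>measure_pmf M)"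
  using measurable_measure_pmf[of f] unfolding measure_pmf_bind
  by (subst measure_pmf.measure_bind[where N = "count_space UNIV"]) auto

text \<open>Given the level-\<open>k\<close> lift \<open>H\<close>, the next lift is connected with
  a probability that depends only on whether \<open>H\<close> is connected, so each level
  contributes one factor.\<close>

lemma prob_iterated_random_lift_connected:
  assumes G: "fin_digraph G" "graph_connected G"
    and r: "card (arcs G) = card (verts G) + r" and "\<forall>j\<in>{1..k}. n j \<ge> 1"
  shows "measure_pmf.prob (iterated_random_lift G n k) {H. graph_connected H} =
    (\<Prod>i = 1..k. lift_conn_prob (r * (\<Prod>j = 1..<i. n j)) (n i))"
  using assms(4)
proof (induction k)
  case 0
  have "graph_connected (relabel root_label root_label G)"
    using G by (subst connected_relabel) (auto intro: inj_on_root_label)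
  then show ?case by simp
next
  case (Suc k)
  let ?M = "iterated_random_lift G n k"
  let ?t = "lift_conn_prob (r * (\<Prod>j = 1..<Suc k. n j)) (n (Suc k))"
  have push: "measure_pmf.prob (map_pmf (relabel push_label push_label) (random_lift H (n (Suc k))))
      {K. graph_connected K} = indicator {K. graph_connected K} H * ?t"
    if H: "H \<in> set_pmf ?M" for H
  proof -
    have fin: "fin_digraph H" and V: "card (verts H) = card (verts G) * (\<Prod>j = 1..k. n j)"
      and E: "card (arcs H) = card (arcs G) * (\<Prod>j = 1..k. n j)"
      using set_pmf_iterated_random_lift[OF G(1) H] by auto
    \<comment> \<open>Restricted to the support, where \<open>K\<close> is known to be a finite
      digraph.\<close>
    have conn: "graph_connected (relabel push_label push_label K) \<longleftrightarrow> graph_connected K"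
      if "K \<in> set_pmf (random_lift H (n (Suc k)))" for K
    proof (rule connected_relabel)
      show "fin_digraph K"
        using that set_pmf_random_lift[OF fin] fin_digraph_perm_lift[OF fin]
        by (auto simp: perm_systems_iff)
    qed (auto intro: inj_on_push_label)
    have "measure_pmf.prob (map_pmf (relabel push_label push_label) (random_lift H (n (Suc k))))
        {K. graph_connected K} =
        measure_pmf.prob (random_lift H (n (Suc k))) {K. graph_connected K}"
      unfolding measure_map_pmf using conn
      by (intro measure_pmf.finite_measure_eq_AE) (auto simp: AE_measure_pmf_iff)
    also have "\<dots> = indicator {K. graph_connected K} H * ?t"
    proof (cases "graph_connected H")
      case True
      have "card (arcs H) = card (verts H) + r * (\<Prod>j = 1..<Suc k. n j)"
        by (simp add: V E r algebra_simps atLeastLessThanSuc_atLeastAtMost)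
      then show ?thesis
        using prob_random_lift_connected[OF fin True] Suc.prems True by simp
    next
      case False
      \<comment> \<open>A lift of a disconnected graph is disconnected, which accounts for the
        indicator being \<open>0\<close>.\<close>
      have "\<not> graph_connected K" if K: "K \<in> set_pmf (random_lift H (n (Suc k)))" for K
      proof
        assume "graph_connected K"
        moreover obtain \<pi> where "\<pi> \<in> perm_systems (arcs H) {1..n (Suc k)}" "K = perm_lift H (n (Suc k)) \<pi>"
          using K by (auto simp: set_pmf_random_lift[OF fin])
        ultimately have "graph_connected H"
          using Suc.prems by (intro connected_perm_liftD[OF fin, of \<pi> "n (Suc k)"]) (auto simp: perm_systems_iff)
        with False show False by simp
      qed
      then have "measure_pmf.prob (random_lift H (n (Suc k))) {K. graph_connected K} = 0"
        by (auto simp: measure_pmf_zero_iff)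
      then show ?thesis using False by simp
    qed
    finally show ?thesis .
  qed
  have "measure_pmf.prob (iterated_random_lift G n (Suc k)) {H. graph_connected H} =
      (\<integral>H. measure_pmf.prob (map_pmf (relabel push_label push_label) (random_lift H (n (Suc k))))
        {K. graph_connected K} \<partial>measure_pmf ?M)"
    by (simp only: iterated_random_lift.simps prob_bind_pmf)
  also have "\<dots> = (\<integral>H. indicator {K. graph_connected K} H * ?t \<partial>measure_pmf ?M)"
    using push by (intro integral_cong_AE) (auto simp: AE_measure_pmf_iff)
  also have "\<dots> = measure_pmf.prob ?M {H. graph_connected H} * ?t"
    by simp
  also have "measure_pmf.prob ?M {H. graph_connected H} =
      (\<Prod>i = 1..k. lift_conn_prob (r * (\<Prod>j = 1..<i. n j)) (n i))"
    using Suc.prems by (intro Suc.IH) auto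
  finally show ?case by simp
qed

section \<open>The product formula with uniform error terms\<close>

text \<open>The O-terms become one function \<open>\<epsilon>\<close> of the list of degrees up to
  level \<open>i\<close> and one constant \<open>C\<close>, both fixed before the graph,
  \<open>k\<close> and \<open>n\<close>. This is possible because each level's probability depends
  only on the excess and on \<open>n i\<close>.\<close>

theorem theorem4p11:
  fixes l :: nat
  assumes "l \<ge> 1"
  shows "\<exists>(C :: real) (\<epsilon> :: nat list \<Rightarrow> real).
    (\<forall>(n :: nat \<Rightarrow> nat) i. i \<ge> 1 \<and> (\<forall>j\<in>{1..i}. n j \<ge> 1) \<longrightarrow>
       \<bar>\<epsilon> (map n [1..<Suc i])\<bar> \<le> C * (1 / real (n i) ^ ((l - 1) * (\<Prod>j=1..<i. n j) + 1))) \<and>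
    (\<forall>(G :: ('v, 'e) pre_digraph) (n :: nat \<Rightarrow> nat) (k :: nat).
       oriented_simple_graph G \<and> graph_connected G \<and>
       int (card (arcs G)) - int (card (verts G)) = int l - 1 \<and>
       k \<ge> 1 \<and> (\<forall>j\<in>{1..k}. n j \<ge> 1) \<longrightarrow>
       measure_pmf.prob (iterated_random_lift G n k) {H. graph_connected H} =
         (1 - 1 / real (n 1) ^ (l - 1) + \<epsilon> [n 1]) *
         (\<Prod>i=2..k. (1 - 1 / real (n i) ^ ((l - 1) * (\<Prod>j=1..<i. n j)) + \<epsilon> (map n [1..<Suc i]))))"
proof -
  \<comment> \<open>The exact deviation from the main term: \<open>last\<close> recovers
    \<open>n i\<close>, and \<open>butlast\<close> the earlier degrees, whose product enters the
    excess.\<close>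
  define \<epsilon> :: "nat list \<Rightarrow> real" where
    "\<epsilon> xs = (let r = (l - 1) * prod_list (butlast xs); m = last xs
      in lift_conn_prob r m - 1 + 1 / real m ^ r)" for xs
  have \<epsilon>: "\<epsilon> (map n [1..<Suc i]) = lift_conn_prob ((l - 1) * (\<Prod>j=1..<i. n j)) (n i)
      - 1 + 1 / real (n i) ^ ((l - 1) * (\<Prod>j=1..<i. n j))" if "i \<ge> 1" for n i
    using that prod.distinct_set_conv_list[of "[1..<i]" n] by (simp add: \<epsilon>_def Let_def)
  show ?thesis
  \<comment> \<open>\<open>27\<close> comes from \<open>lift_conn_prob_approx\<close>; it serves
    every excess, hence every level.\<close>
  proof (intro exI[of _ 27] exI[of _ \<epsilon>] conjI allI impI)
    fix n :: "nat \<Rightarrow> nat" and i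
    assume "i \<ge> 1 \<and> (\<forall>j\<in>{1..i}. n j \<ge> 1)"
    then show "\<bar>\<epsilon> (map n [1..<Suc i])\<bar> \<le> 27 * (1 / real (n i) ^ ((l - 1) * (\<Prod>j=1..<i. n j) + 1))"
      using lift_conn_prob_approx[of "n i"] by (subst \<epsilon>) auto
  next
    fix G :: "('v, 'e) pre_digraph" and n :: "nat \<Rightarrow> nat" and k
    assume *: "oriented_simple_graph G \<and> graph_connected G \<and>
       int (card (arcs G)) - int (card (verts G)) = int l - 1 \<and>
       k \<ge> 1 \<and> (\<forall>j\<in>{1..k}. n j \<ge> 1)"
    let ?f = "\<lambda>i. 1 - 1 / real (n i) ^ ((l - 1) * (\<Prod>j=1..<i. n j)) + \<epsilon> (map n [1..<Suc i])"
    \<comment> \<open>With \<open>l \<ge> 1\<close> the natural number \<open>l - 1\<close> agrees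
      with the integer excess.\<close>
    have "card (arcs G) = card (verts G) + (l - 1)"
      using * assms by linarith
    then have "measure_pmf.prob (iterated_random_lift G n k) {H. graph_connected H} =
        (\<Prod>i = 1..k. lift_conn_prob ((l - 1) * (\<Prod>j = 1..<i. n j)) (n i))"
      using * by (intro prob_iterated_random_lift_connected) (auto simp: oriented_simple_graph_def)
    also have "\<dots> = (\<Prod>i = 1..k. ?f i)"
    proof (intro prod.cong refl)
      fix i assume "i \<in> {1..k}"
      then show "lift_conn_prob ((l - 1) * (\<Prod>j = 1..<i. n j)) (n i) = ?f i"
        using \<epsilon>[of i n] by (simp del: upt_Suc)
    qed
    \<comment> \<open>At the first level the product of earlier degrees is empty, so the exponent is
      \<open>l - 1\<close>.\<close>
    also have "\<dots> = ?f 1 * (\<Prod>i = 2..k. ?f i)"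
      using * by (subst prod.atLeast_Suc_atMost) (simp_all add: numeral_2_eq_2)
    also have "?f 1 = 1 - 1 / real (n 1) ^ (l - 1) + \<epsilon> [n 1]"
      by simp
    finally show "measure_pmf.prob (iterated_random_lift G n k) {H. graph_connected H} =
         (1 - 1 / real (n 1) ^ (l - 1) + \<epsilon> [n 1]) * (\<Prod>i=2..k. ?f i)" .
  qed
qed

end
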